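(* Random sampling is always consistent under the cross-entropy loss. That is: let $p^*$ be any probability distribution over $\mathcal X\times\mathcal Y$, let $x\in\mathcal X$, and let $(p^n_{ntp})_{n\ge0}$ be a sequence of next-token predictors such that for every prefix $y_{[j-1]}$ of a sequence $y\in\mathcal Y$, $1\le j\le L$, $$\mathrm{KL}\big(p^*(\cdot\mid x,y_{[j-1]})\,\|\,p^n_{ntp}(\cdot\mid x,y_{[j-1]})\big)\to0\quad\text{as } n\to\infty.$$ Let $p_{RS(p^n_{ntp})\mid x}$ be the distribution of the output of random sampling with $p^n_{ntp}$ on input $x$. Then $$\lim_{n\to\infty}\mathbb E_{y\sim p^*(\cdot\mid x)}\big[-\log p_{RS(p^n_{ntp})\mid x}(y)\big]=\inf_{q}\ \mathbb E_{y\sim p^*(\cdot\mid x)}\big[-\log q(y)\big],$$ where the infimum is over all probability distributions $q$ of output sequences.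
   Context: $\mathcal V$ is a finite vocabulary, $*\notin\mathcal V$ a null (padding) token, $L\in\mathbb N$; $\mathcal Y$ is a set of sequences of length $L$ of the form $y_1\cdots y_j*\cdots*$ with $y_i\in\mathcal V$, $j\le L$. $y_{[i]}=y_1\cdots y_i$ ($y_{[0]}$ is empty). A next-token predictor gives, for an input $x$ and each prefix, a probability distribution over the next token in $\mathcal V\cup\{*\}$ (all mass on $*$ if the prefix contains $*$). Random sampling on input $x$ with next-token predictor $q$: start with the empty string $y$ and, until the length is $L$, draw a token from $q(\cdot\mid x,y)$ and append it to $y$. For a decoder $\mathcal D$ the cross-entropy loss on input $x$ is $\mathbb E_{y\sim p^*(\cdot\mid x)}[-\log p_{\mathcal D(p_{ntp})\mid x}(y)]$, with $p_{\mathcal D(p_{ntp})\mid x}$ the distribution of the decoder's output, and with $0\cdot\log 0=0$ and $-\log0=+\infty$. *)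

theory Defs
  imports "HOL-Probability.Probability"
begin

text \<open>
  A token is an element of \<open>'v option\<close>: \<open>Some v\<close> is the vocabulary item \<open>v\<close>,
  \<open>None\<close> is the null (padding) token.
\<close>

definition padded_seqs :: "nat \<Rightarrow> 'v option list set" where
  "padded_seqs L = {map Some u @ replicate (L - length u) None | u. length u \<le> L}"

text \<open>
  A predictor is a total function; its values are only constrained (and only used) on inputs
  in \<open>X\<close> and on strings shorter than \<open>L\<close>.
\<close>

definition next_token_predictor ::
    "'x set \<Rightarrow> nat \<Rightarrow> ('x \<Rightarrow> 'v option list \<Rightarrow> 'v option pmf) \<Rightarrow> bool" where
  "next_token_predictor X L q \<longleftrightarrow>
     (\<forall>x\<in>X. \<forall>w. length w < L \<and> None \<in> set w \<longrightarrow> q x w = return_pmf None)"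

text \<open>
  \<open>sample_from L q y\<close> is the distribution of the result of the sampling loop when it is
  started in the string \<open>y\<close>; here \<open>q\<close> is a predictor already applied to the input.
\<close>

function sample_from ::
    "nat \<Rightarrow> ('v option list \<Rightarrow> 'v option pmf) \<Rightarrow> 'v option list \<Rightarrow> 'v option list pmf" where
  "sample_from L q y =
     (if length y < L then bind_pmf (q y) (\<lambda>t. sample_from L q (y @ [t])) else return_pmf y)"
  by pat_completeness auto
termination
  by (relation "Wellfounded.measure (\<lambda>(L, q, y). L - length y)") auto

declare sample_from.simps [simp del]

definition random_sampling ::
    "nat \<Rightarrow> ('v option list \<Rightarrow> 'v option pmf) \<Rightarrow> 'v option list pmf" where
  "random_sampling L q = sample_from L q []"

text \<open>
  \<open>P\<close> is the joint law on \<open>X \<times> Y\<close>, and \<open>pc\<close> is a (regular) conditional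
  distribution of the output given the input. At inputs of positive mass it is the elementary
  conditional distribution (see \<open>conditional_output_atom\<close> below); at other inputs it is any
  fixed version.
\<close>

definition conditional_output ::
    "'x measure \<Rightarrow> 'y set \<Rightarrow> ('x \<times> 'y) measure \<Rightarrow> ('x \<Rightarrow> 'y pmf) \<Rightarrow> bool" where
  "conditional_output MX Y P pc \<longleftrightarrow>
     (\<forall>x\<in>space MX. set_pmf (pc x) \<subseteq> Y) \<and>
     (\<forall>y\<in>Y. (\<lambda>x. pmf (pc x) y) \<in> borel_measurable MX) \<and>
     (\<forall>A\<in>sets MX. \<forall>y\<in>Y.
        emeasure P (A \<times> {y}) = (\<integral>\<^sup>+x\<in>A. ennreal (pmf (pc x) y) \<partial>distr P MX fst))"

lemma conditional_output_atom:
  assumes "sets P = sets (MX \<Otimes>\<^sub>M count_space Y)"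
    and "conditional_output MX Y P pc"
    and "{x} \<in> sets MX" and "y \<in> Y"
  shows "emeasure P {(x, y)} = ennreal (pmf (pc x) y) * emeasure P ({x} \<times> Y)"
proof -
  have fst: "fst \<in> measurable P MX"
    using assms(1) by (subst measurable_cong_sets[OF assms(1) refl]) simp
  have sp: "space P = space MX \<times> Y"
    using sets_eq_imp_space_eq[OF assms(1)] by (simp add: space_pair_measure)
  have x: "x \<in> space MX"
    using sets.sets_into_space[OF assms(3)] by simp
  have "emeasure P ({x} \<times> {y}) =
      (\<integral>\<^sup>+x'\<in>{x}. ennreal (pmf (pc x') y) \<partial>distr P MX fst)"
    using assms(2-4) unfolding conditional_output_def by blast
  also have "\<dots> = (\<integral>\<^sup>+x'\<in>{x}. ennreal (pmf (pc x) y) \<partial>distr P MX fst)"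
    by (rule nn_integral_cong) (auto simp: indicator_def)
  also have "\<dots> = ennreal (pmf (pc x) y) * emeasure (distr P MX fst) {x}"
    using assms(3) by (simp add: nn_integral_cmult_indicator)
  also have "emeasure (distr P MX fst) {x} = emeasure P ({x} \<times> Y)"
    using fst assms(3) x sp
    by (subst emeasure_distr) (auto intro!: arg_cong[where f = "emeasure P"])
  finally show ?thesis by simp
qed

text \<open>
  The set of sequences that begin with \<open>w\<close>; the next-token distribution after \<open>w\<close> is
  meaningful only if this set has positive probability (and \<open>w\<close> is shorter than \<open>L\<close>).
\<close>

definition begins_with :: "'a list \<Rightarrow> 'a list set" where
  "begins_with w = {z. take (length w) z = w}"

definition next_token :: "'a list pmf \<Rightarrow> 'a list \<Rightarrow> 'a pmf" where
  "next_token p w = map_pmf (\<lambda>z. z ! length w) (cond_pmf p (begins_with w))"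

text \<open>
  The library's real-valued \<open>KL_divergence b M N\<close> is the divergence of \<open>N\<close> from \<open>M\<close>, i.e.
  \<open>KL(N || M)\<close>, and is only meaningful if \<open>N\<close> is absolutely continuous with respect to \<open>M\<close>;
  otherwise the divergence is infinite.
\<close>

definition KL :: "'a pmf \<Rightarrow> 'a pmf \<Rightarrow> ereal" where
  "KL p q =
     (if absolutely_continuous (measure_pmf q) (measure_pmf p)
      then ereal (KL_divergence (exp 1) (measure_pmf q) (measure_pmf p)) else \<infinity>)"

lemma absolutely_continuous_pmf_iff:
  "absolutely_continuous (measure_pmf q) (measure_pmf p) \<longleftrightarrow> set_pmf p \<subseteq> set_pmf q"
proof
  assume ac: "absolutely_continuous (measure_pmf q) (measure_pmf p)"
  show "set_pmf p \<subseteq> set_pmf q"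
  proof
    fix t assume t: "t \<in> set_pmf p"
    show "t \<in> set_pmf q"
    proof (rule ccontr)
      assume "t \<notin> set_pmf q"
      then have "{t} \<in> null_sets (measure_pmf q)"
        by (simp add: null_sets_def emeasure_pmf_single set_pmf_eq)
      then have "{t} \<in> null_sets (measure_pmf p)"
        using ac by (auto simp: absolutely_continuous_def)
      then show False
        using t by (simp add: null_sets_def emeasure_pmf_single set_pmf_eq)
    qed
  qed
next
  assume "set_pmf p \<subseteq> set_pmf q"
  then show "absolutely_continuous (measure_pmf q) (measure_pmf p)"
    by (auto simp: absolutely_continuous_def null_sets_def measure_pmf.emeasure_eq_measure
        measure_pmf_zero_iff)
qed

lemma KL_finite:
  fixes p q :: "'a::finite pmf"
  shows "KL p q = (if set_pmf p \<subseteq> set_pmf q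
                   then ereal (\<Sum>t\<in>UNIV. pmf p t * ln (pmf p t / pmf q t)) else \<infinity>)"
proof (cases "set_pmf p \<subseteq> set_pmf q")
  case True
  interpret sigma_finite_measure "count_space (UNIV :: 'a set)"
    by (rule sigma_finite_measure_count_space_finite) simp
  have "KL_divergence (exp 1) (measure_pmf q) (measure_pmf p) =
      (\<integral>t. pmf p t * log (exp 1) (pmf p t / pmf q t) \<partial>count_space UNIV)"
    unfolding measure_pmf_eq_density using True
    by (intro KL_density_density) (auto simp: AE_count_space set_pmf_eq)
  also have "\<dots> = (\<Sum>t\<in>UNIV. pmf p t * ln (pmf p t / pmf q t))"
    by (simp add: lebesgue_integral_count_space_finite log_def)
  finally show ?thesis
    using True by (simp add: KL_def absolutely_continuous_pmf_iff)
qed (simp add: KL_def absolutely_continuous_pmf_iff)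

definition neg_log :: "real \<Rightarrow> ennreal" where
  "neg_log r = (if r = 0 then \<infinity> else ennreal (- ln r))"

text \<open>The convention \<open>0 * \<infinity> = 0\<close> is that of the Lebesgue integral.\<close>

definition cross_entropy :: "'a pmf \<Rightarrow> 'a pmf \<Rightarrow> ennreal" where
  "cross_entropy p q = (\<integral>\<^sup>+y. neg_log (pmf q y) \<partial>measure_pmf p)"

end

theory Submission
  imports Defs
begin

text \<open>
  The probability that random sampling outputs \<open>y\<close> is the product of the probabilities the
  predictor gives to the successive tokens of \<open>y\<close>. Convergence of the divergences to \<open>0\<close> forces
  each factor to converge to the true next-token probability (the divergence dominates the squared
  Hellinger distance), so on the finite support of \<open>p\<^sup>*\<close> the output probabilities converge to those
  of \<open>p\<^sup>*\<close> and the loss converges to the entropy of \<open>p\<^sup>*\<close>, which is the infimum by Gibbs' inequality.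
\<close>

text \<open>The loop only appends tokens. This is what leaves a single live branch of the bind when
  the probability of a fixed output is computed.\<close>

lemma set_sample_from: "set_pmf (sample_from L q y) \<subseteq> begins_with y"
proof (induction L q y rule: sample_from.induct)
  case (1 L q y)
  have "z \<in> begins_with y" if "z \<in> begins_with (y @ [t])" for t and z
  proof -
    have "take (length y) (take (Suc (length y)) z) = y"
      using that by (simp add: begins_with_def)
    then show ?thesis
      by (simp add: begins_with_def)
  qed
  then show ?case
    using 1 by (subst sample_from.simps) (fastforce simp: begins_with_def split: if_splits)
qed

text \<open>Induction on the part still to be drawn, with \<open>w\<close> generalised because each
  draw moves a token from \<open>z\<close> to \<open>w\<close>. The length assumption makes the loop
  stop exactly when \<open>z\<close> is used up.\<close>

lemma pmf_sample_from:
  assumes "length w + length z = L"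
  shows "pmf (sample_from L q w) (w @ z) = (\<Prod>i<length z. pmf (q (w @ take i z)) (z ! i))"
  using assms
proof (induction z arbitrary: w)
  case Nil
  then show ?case
    by (simp add: sample_from.simps[of L q w])
next
  case (Cons a z)
  let ?f = "\<lambda>t. pmf (sample_from L q (w @ [t])) (w @ a # z)"
  have "t = a" if "?f t \<noteq> 0" for t
  proof -
    have "w @ a # z \<in> begins_with (w @ [t])"
      using that set_sample_from[of L q "w @ [t]"] by (auto simp: set_pmf_iff)
    then show ?thesis
      by (simp add: begins_with_def)
  qed
  then have "pmf (sample_from L q w) (w @ a # z) = ?f a * pmf (q w) a"
    using Cons.prems
    by (simp add: sample_from.simps[of L q w] pmf_bind integral_measure_pmf_real[where A = "{a}"])
  also have "?f a = (\<Prod>i<length z. pmf (q (w @ a # take i z)) (z ! i))"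
    using Cons.IH[of "w @ [a]"] Cons.prems by simp
  finally show ?case
    by (simp add: prod.lessThan_Suc_shift del: prod.lessThan_Suc)
qed

lemma pmf_random_sampling:
  assumes "length y = L"
  shows "pmf (random_sampling L q) y = (\<Prod>i<L. pmf (q (take i y)) (y ! i))"
  using pmf_sample_from[of "[]" y L q] assms by (simp add: random_sampling_def)

text \<open>Makes conditioning legitimate at every prefix met along a sequence of positive
  probability; \<open>y\<close> itself is the witness.\<close>

lemma prob_begins_with_pos:
  assumes "y \<in> set_pmf p"
  shows "measure_pmf.prob p (begins_with (take i y)) > 0"
  using assms by (intro measure_pmf_posI[of y]) (auto simp: begins_with_def min_def)

lemma pmf_next_token:
  assumes len: "\<And>z. z \<in> set_pmf p \<Longrightarrow> length w < length z"
    and pos: "measure_pmf.prob p (begins_with w) > 0"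
  shows "pmf (next_token p w) t =
    measure_pmf.prob p (begins_with (w @ [t])) / measure_pmf.prob p (begins_with w)"
proof -
  have ne: "set_pmf p \<inter> begins_with w \<noteq> {}"
    using pos by (metis less_irrefl measure_pmf_zero_iff)
  have "pmf (next_token p w) t =
      measure_pmf.prob (cond_pmf p (begins_with w)) ((\<lambda>z. z ! length w) -` {t})"
    by (simp add: next_token_def pmf_map)
  also have "\<dots> = measure_pmf.prob p (begins_with w \<inter> (\<lambda>z. z ! length w) -` {t})
      / measure_pmf.prob p (begins_with w)"
    using pos unfolding cond_pmf.rep_eq[OF ne]
    by (intro measure_uniform_measure) (auto simp: measure_pmf.emeasure_eq_measure)
  also have "measure_pmf.prob p (begins_with w \<inter> (\<lambda>z. z ! length w) -` {t}) =
      measure_pmf.prob p (begins_with (w @ [t]))"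
  proof -
    \<comment> \<open>Lists outside the support may be too short for \<open>z ! length w\<close> to
      be an entry, so the two events are compared on the support only.\<close>
    have "z \<in> begins_with w \<inter> (\<lambda>z. z ! length w) -` {t} \<longleftrightarrow> z \<in> begins_with (w @ [t])"
      if "z \<in> set_pmf p" for z
      using len[OF that] by (auto simp: begins_with_def take_Suc_conv_app_nth)
    then show ?thesis
      by (intro measure_prob_cong_0) (auto simp: set_pmf_iff)
  qed
  finally show ?thesis .
qed

text \<open>Chain rule: each factor is a quotient of consecutive prefix probabilities, so the
  product telescopes, starting from 1 at the empty prefix.\<close>

lemma pmf_eq_prod_next_token:
  assumes len: "\<And>z. z \<in> set_pmf p \<Longrightarrow> length z = L" and y: "y \<in> set_pmf p"
  shows "pmf p y = (\<Prod>i<L. pmf (next_token p (take i y)) (y ! i))"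
proof -
  let ?b = "\<lambda>i. measure_pmf.prob p (begins_with (take i y))"
  have "(\<Prod>i<k. pmf (next_token p (take i y)) (y ! i)) = ?b k" if "k \<le> L" for k
    using that
  proof (induction k)
    case 0
    then show ?case
      by (simp add: begins_with_def)
  next
    case (Suc k)
    have "pmf (next_token p (take k y)) (y ! k) = ?b (Suc k) / ?b k"
      using Suc.prems len y prob_begins_with_pos[OF y, of k]
      by (subst pmf_next_token) (auto simp: take_Suc_conv_app_nth)
    then show ?case
      using Suc prob_begins_with_pos[OF y, of k] by simp
  qed
  \<comment> \<open>All sequences in the support have length \<open>L\<close>, so \<open>y\<close>
    is the only one among them that begins with all of \<open>y\<close>.\<close>
  moreover have "?b L = measure_pmf.prob p {y}"
    using len y
    by (intro measure_prob_cong_0) (auto simp: begins_with_def simp flip: set_pmf_iff intro: ccontr)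
  ultimately show ?thesis
    by (simp add: measure_pmf_single)
qed

text \<open>Termwise, \<open>ln u <= u - 1\<close> is applied at the square root of the ratio of
  \<open>pmf q t\<close> to \<open>pmf p t\<close>. If the support of \<open>p\<close> is not
  contained in that of \<open>q\<close>, the divergence is infinite.\<close>

lemma Hellinger_le_KL:
  fixes p q :: "'a::finite pmf"
  shows "ereal (\<Sum>t\<in>UNIV. (sqrt (pmf p t) - sqrt (pmf q t))\<^sup>2) \<le> KL p q"
proof (cases "set_pmf p \<subseteq> set_pmf q")
  case True
  have le: "2 * pmf p t - 2 * sqrt (pmf p t * pmf q t) \<le> pmf p t * ln (pmf p t / pmf q t)" for t
  proof (cases "pmf p t = 0")
    case False
    then have p: "pmf p t > 0" and q: "pmf q t > 0"
      using True by (auto simp: set_pmf_iff pmf_positive)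
    have "ln (sqrt (pmf q t / pmf p t)) \<le> sqrt (pmf q t / pmf p t) - 1"
      using p q by (intro ln_le_minus_one) simp
    then have "2 - 2 * sqrt (pmf q t / pmf p t) \<le> ln (pmf p t / pmf q t)"
      using p q by (simp add: ln_sqrt ln_div)
    then have "pmf p t * (2 - 2 * sqrt (pmf q t / pmf p t)) \<le> pmf p t * ln (pmf p t / pmf q t)"
      using p by (intro mult_left_mono) auto
    moreover have "pmf p t * sqrt (pmf q t / pmf p t) = sqrt (pmf p t * pmf q t)"
      using p by (simp add: real_sqrt_divide real_sqrt_mult field_simps)
    ultimately show ?thesis
      by (simp add: algebra_simps)
  qed simp
  have "(\<Sum>t\<in>UNIV. (sqrt (pmf p t) - sqrt (pmf q t))\<^sup>2) =
      (\<Sum>t\<in>UNIV. pmf p t + pmf q t - 2 * sqrt (pmf p t * pmf q t))"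
    by (simp add: power2_diff real_sqrt_mult mult.assoc)
  \<comment> \<open>Both \<open>pmf p\<close> and \<open>pmf q\<close> sum to 1, so one may replace
    the other under the sum.\<close>
  also have "\<dots> = (\<Sum>t\<in>UNIV. 2 * pmf p t - 2 * sqrt (pmf p t * pmf q t))"
    by (simp add: sum.distrib sum_subtractf sum_pmf_eq_1 flip: sum_distrib_left)
  also have "\<dots> \<le> (\<Sum>t\<in>UNIV. pmf p t * ln (pmf p t / pmf q t))"
    by (intro sum_mono le)
  finally show ?thesis
    using True by (simp add: KL_finite)
qed (simp add: KL_finite)

lemma tendsto_pmf_of_KL:
  fixes p :: "'a::finite pmf"
  assumes "(\<lambda>n. KL p (q n)) \<longlonglongrightarrow> 0"
  shows "(\<lambda>n. pmf (q n) t) \<longlonglongrightarrow> pmf p t"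
proof -
  have le: "ereal ((sqrt (pmf (q n) t) - sqrt (pmf p t))\<^sup>2) \<le> KL p (q n)" for n
  proof -
    have "(sqrt (pmf p t) - sqrt (pmf (q n) t))\<^sup>2 \<le>
        (\<Sum>t\<in>UNIV. (sqrt (pmf p t) - sqrt (pmf (q n) t))\<^sup>2)"
      by (intro member_le_sum) auto
    then have "ereal ((sqrt (pmf (q n) t) - sqrt (pmf p t))\<^sup>2) \<le>
        ereal (\<Sum>t\<in>UNIV. (sqrt (pmf p t) - sqrt (pmf (q n) t))\<^sup>2)"
      by (simp add: power2_commute)
    then show ?thesis
      using Hellinger_le_KL by (rule order_trans)
  qed
  \<comment> \<open>The squeeze takes place in \<open>ereal\<close>, so indices with infinite
    divergence need no separate treatment.\<close>
  have "(\<lambda>n. ereal ((sqrt (pmf (q n) t) - sqrt (pmf p t))\<^sup>2)) \<longlonglongrightarrow> 0"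
    by (rule tendsto_sandwich[OF _ _ tendsto_const assms]) (simp_all add: le)
  then have "(\<lambda>n. sqrt ((sqrt (pmf (q n) t) - sqrt (pmf p t))\<^sup>2)) \<longlonglongrightarrow> sqrt 0"
    by (intro tendsto_real_sqrt) (simp add: zero_ereal_def)
  then have "(\<lambda>n. sqrt (pmf (q n) t)) \<longlonglongrightarrow> sqrt (pmf p t)"
    by (simp add: tendsto_rabs_zero_iff LIM_zero_iff)
  then have "(\<lambda>n. (sqrt (pmf (q n) t))\<^sup>2) \<longlonglongrightarrow> (sqrt (pmf p t))\<^sup>2"
    by (rule tendsto_power)
  then show ?thesis
    by simp
qed

text \<open>The limit is positive, so \<open>f n\<close> is eventually nonzero and the infinite
  branch of \<open>neg_log\<close> is left for good.\<close>

lemma tendsto_neg_log: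
  assumes "(f \<longlongrightarrow> r) F" and "r > 0"
  shows "((\<lambda>n. neg_log (f n)) \<longlongrightarrow> neg_log r) F"
proof -
  have "((\<lambda>n. ennreal (- ln (f n))) \<longlongrightarrow> ennreal (- ln r)) F"
    using assms by (intro tendsto_ennrealI tendsto_minus tendsto_ln) auto
  moreover have "\<forall>\<^sub>F n in F. ennreal (- ln (f n)) = neg_log (f n)"
    using order_tendstoD(1)[OF assms] by eventually_elim (simp add: neg_log_def)
  ultimately have "((\<lambda>n. neg_log (f n)) \<longlongrightarrow> ennreal (- ln r)) F"
    by (rule Lim_transform_eventually)
  then show ?thesis
    using assms(2) by (simp add: neg_log_def)
qed

lemma cross_entropy_finite:
  assumes "finite (set_pmf p)"
  shows "cross_entropy p r = (\<Sum>y\<in>set_pmf p. ennreal (pmf p y) * neg_log (pmf r y))"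
  using assms by (simp add: cross_entropy_def nn_integral_measure_pmf_finite mult.commute)

text \<open>Support inclusion excludes infinite terms. Probabilities are at most 1, so no summand is
  negative and \<open>ennreal\<close> truncates nothing.\<close>

lemma cross_entropy_finite_real:
  assumes "finite (set_pmf p)" and "set_pmf p \<subseteq> set_pmf r"
  shows "cross_entropy p r = ennreal (\<Sum>y\<in>set_pmf p. pmf p y * - ln (pmf r y))"
proof -
  have "ennreal (pmf p y) * neg_log (pmf r y) = ennreal (pmf p y * - ln (pmf r y)) \<and>
      pmf p y * - ln (pmf r y) \<ge> 0" if "y \<in> set_pmf p" for y
  proof -
    have "pmf r y > 0"
      using that assms(2) by (auto intro: pmf_positive)
    then have "- ln (pmf r y) \<ge> 0" and "neg_log (pmf r y) = ennreal (- ln (pmf r y))"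
      by (simp_all add: neg_log_def pmf_le_1)
    then show ?thesis
      by (metis ennreal_mult mult_nonneg_nonneg pmf_nonneg)
  qed
  then show ?thesis
    using assms(1) by (simp add: cross_entropy_finite sum_ennreal del: mult_minus_right)
qed

text \<open>Gibbs' inequality, from \<open>ln u <= u - 1\<close> at the ratio of
  \<open>pmf r y\<close> to \<open>pmf p y\<close>. A support point of \<open>p\<close> missed by
  \<open>r\<close> makes the right side infinite.\<close>

lemma cross_entropy_self_le:
  assumes fin: "finite (set_pmf p)"
  shows "cross_entropy p p \<le> cross_entropy p r"
proof (cases "set_pmf p \<subseteq> set_pmf r")
  case True
  have "(\<Sum>y\<in>set_pmf p. pmf p y * ln (pmf r y) - pmf p y * ln (pmf p y)) \<le>
      (\<Sum>y\<in>set_pmf p. pmf r y - pmf p y)"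
  proof (rule sum_mono)
    fix y
    assume "y \<in> set_pmf p"
    then have p: "pmf p y > 0" and r: "pmf r y > 0"
      using True by (auto intro: pmf_positive)
    then have "pmf p y * ln (pmf r y / pmf p y) \<le> pmf p y * (pmf r y / pmf p y - 1)"
      by (intro mult_left_mono ln_le_minus_one) auto
    then show "pmf p y * ln (pmf r y) - pmf p y * ln (pmf p y) \<le> pmf r y - pmf p y"
      using p r by (simp add: ln_div right_diff_distrib)
  qed
  \<comment> \<open>\<open>r\<close> may have mass outside the support of \<open>p\<close>, so its
    sum there is only at most 1.\<close>
  also have "\<dots> \<le> 0"
    using fin measure_measure_pmf_finite[OF fin, of r] measure_pmf.prob_le_1[of r "set_pmf p"]
    by (simp add: sum_subtractf sum_pmf_eq_1)
  finally show ?thesis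
    using fin True
    by (simp add: cross_entropy_finite_real sum_subtractf sum_negf ennreal_leI)
next
  case False
  then obtain y where "y \<in> set_pmf p" "pmf r y = 0"
    by (auto simp: set_pmf_iff)
  then have "ennreal (pmf p y) * neg_log (pmf r y) = \<infinity>"
    by (simp add: neg_log_def ennreal_mult_top pmf_positive pmf_eq_0_set_pmf)
  moreover have "ennreal (pmf p y) * neg_log (pmf r y) \<le> cross_entropy p r"
    using fin \<open>y \<in> set_pmf p\<close> unfolding cross_entropy_finite[OF fin]
    by (intro member_le_sum) auto
  ultimately show ?thesis
    by (simp add: top_unique)
qed

lemma length_padded_seqs: "y \<in> padded_seqs L \<Longrightarrow> length y = L"
  by (auto simp: padded_seqs_def)

theorem proposition5:
  fixes MX :: "'x measure"
    and L :: nat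
    and Y :: "'v::finite option list set"
    and P :: "('x \<times> 'v option list) measure"
    and pc :: "'x \<Rightarrow> 'v option list pmf"
    and x :: 'x
    and q :: "nat \<Rightarrow> 'x \<Rightarrow> 'v option list \<Rightarrow> 'v option pmf"
  assumes Y: "Y \<subseteq> padded_seqs L"
    and prob: "prob_space P" and sets_P: "sets P = sets (MX \<Otimes>\<^sub>M count_space Y)"
    and cond: "conditional_output MX Y P pc"
    and x: "x \<in> space MX"
    and pred: "\<And>n. next_token_predictor (space MX) L (q n)"
    and KL_lim: "\<And>y j. \<lbrakk>y \<in> Y; 1 \<le> j; j \<le> L;
        measure_pmf.prob (pc x) (begins_with (take (j - 1) y)) > 0\<rbrakk> \<Longrightarrow>
        (\<lambda>n. KL (next_token (pc x) (take (j - 1) y)) (q n x (take (j - 1) y)))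
          \<longlonglongrightarrow> 0"
  shows "(\<lambda>n. cross_entropy (pc x) (random_sampling L (q n x)))
           \<longlonglongrightarrow> (INF r\<in>{r. set_pmf r \<subseteq> padded_seqs L}. cross_entropy (pc x) r)"
proof -
  let ?p = "pc x"
  have p: "set_pmf ?p \<subseteq> Y"
    using cond x by (auto simp: conditional_output_def)
  have len: "length z = L" if "z \<in> set_pmf ?p" for z
    using that p Y by (auto intro: length_padded_seqs)
  have fin: "finite (set_pmf ?p)"
    by (rule finite_subset[OF _ finite_lists_length_eq[of UNIV L]]) (auto simp: len)
  have "(\<lambda>n. pmf (random_sampling L (q n x)) y) \<longlonglongrightarrow> pmf ?p y" if y: "y \<in> set_pmf ?p" for y
  proof -
    \<comment> \<open>Position \<open>i\<close>, counted from 0, corresponds to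
      \<open>j = Suc i\<close> in \<open>KL_lim\<close>.\<close>
    have "(\<lambda>n. pmf (q n x (take i y)) (y ! i)) \<longlonglongrightarrow> pmf (next_token ?p (take i y)) (y ! i)"
      if "i < L" for i
      using KL_lim[of y "Suc i"] that y p prob_begins_with_pos[OF y, of i]
      by (intro tendsto_pmf_of_KL) auto
    then have "(\<lambda>n. \<Prod>i<L. pmf (q n x (take i y)) (y ! i))
        \<longlonglongrightarrow> (\<Prod>i<L. pmf (next_token ?p (take i y)) (y ! i))"
      by (intro tendsto_prod) auto
    then show ?thesis
      using len y by (simp add: pmf_random_sampling pmf_eq_prod_next_token[of ?p L])
  qed
  \<comment> \<open>The loss is a sum over the finite support, where the limits
    \<open>pmf ?p y\<close> are positive, so convergence passes through \<open>neg_log\<close> term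
    by term.\<close>
  then have "(\<lambda>n. cross_entropy ?p (random_sampling L (q n x))) \<longlonglongrightarrow> cross_entropy ?p ?p"
    unfolding cross_entropy_finite[OF fin]
    by (intro tendsto_sum ennreal_tendsto_cmult tendsto_neg_log) (auto intro: pmf_positive)
  \<comment> \<open>\<open>?p\<close> is itself admissible, being supported in \<open>Y\<close>, so
    the infimum is attained at \<open>?p\<close>.\<close>
  also have "cross_entropy ?p ?p = (INF r\<in>{r. set_pmf r \<subseteq> padded_seqs L}. cross_entropy ?p r)"
    using p Y by (intro antisym INF_greatest INF_lower cross_entropy_self_le fin) auto
  finally show ?thesis .
qed

end
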